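(* Let $k\ge 2$ and let $a_1\ge\cdots\ge a_k\ge 1$ be integers. Let $F=\bigcup_{i=1}^k P_{2a_i}$ and $h=\sum_{i=1}^k a_i-1\ge 1$. Let $G$ be a connected graph of order $n$, where $n\ge 2h+2$. If $\delta(G)\ge h$, then $F\subseteq G$, unless one of the following holds: (i) $G\subseteq S_{n,h}$; (ii) $F=2P_{2a_1}$ and $G=L_{t,h}$, where $n=th+1$.
   Context: All graphs are finite, simple and undirected; $\delta(G)$ is the minimum degree of $G$. $P_m$ is the path of order $m$ (on $m$ vertices), $K_m$ the complete graph of order $m$. For disjoint graphs, $G\bigcup H$ is the disjoint union, $G\bigvee H$ is the join (add all edges between $G$ and $H$ to the disjoint union), $kG$ is the disjoint union of $k$ copies of $G$, and $\overline{G}$ is the complement. $H\subseteq G$ means that $G$ contains $H$ as a (not necessarily induced) subgraph, up to isomorphism; equality of graphs means isomorphism. $S_{n,h}:=K_h\bigvee\overline{K}_{n-h}$. $L_{t,h}:=K_1\bigvee tK_h$ (that is, $t$ copies of $K_{h+1}$ sharing one common vertex). *)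

theory Defs
  imports "Graph_Theory.Graph_Theory"
begin

text \<open>
  A finite simple undirected graph is a \<^locale>\<open>pair_graph\<close>: a finite vertex set with a finite,
  symmetric, irreflexive set of arcs, each edge \<open>uv\<close> being represented by the two arcs
  \<open>(u, v)\<close> and \<open>(v, u)\<close>.
\<close>

definition min_degree :: "'a pair_pre_digraph \<Rightarrow> nat" where
  "min_degree G = Min (out_degree (with_proj G) ` pverts G)"

definition path_graph :: "nat \<Rightarrow> nat pair_pre_digraph" where
  "path_graph m = \<lparr> pverts = {..<m},
     parcs = {(i, j). i < m \<and> j < m \<and> (j = Suc i \<or> i = Suc j)} \<rparr>"

definition complete_graph :: "nat \<Rightarrow> nat pair_pre_digraph" where
  "complete_graph m = \<lparr> pverts = {..<m}, parcs = {(i, j). i < m \<and> j < m \<and> i \<noteq> j} \<rparr>"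

definition complement_graph :: "'a pair_pre_digraph \<Rightarrow> 'a pair_pre_digraph" where
  "complement_graph G = \<lparr> pverts = pverts G,
     parcs = {(u, v). u \<in> pverts G \<and> v \<in> pverts G \<and> u \<noteq> v \<and> (u, v) \<notin> parcs G} \<rparr>"

text \<open>
  Disjointness in unions and joins is enforced by tagging the vertices, with \<^const>\<open>Inl\<close> and
  \<^const>\<open>Inr\<close> for two graphs and with the index for a family of graphs.
\<close>

definition disjoint_union ::
    "'a pair_pre_digraph \<Rightarrow> 'b pair_pre_digraph \<Rightarrow> ('a + 'b) pair_pre_digraph" where
  "disjoint_union G H = \<lparr> pverts = pverts G <+> pverts H,
     parcs = map_prod Inl Inl ` parcs G \<union> map_prod Inr Inr ` parcs H \<rparr>"

definition graph_join ::
    "'a pair_pre_digraph \<Rightarrow> 'b pair_pre_digraph \<Rightarrow> ('a + 'b) pair_pre_digraph" where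
  "graph_join G H = \<lparr> pverts = pverts (disjoint_union G H),
     parcs = parcs (disjoint_union G H)
       \<union> (Inl ` pverts G) \<times> (Inr ` pverts H) \<union> (Inr ` pverts H) \<times> (Inl ` pverts G) \<rparr>"

definition disjoint_UNION ::
    "'i set \<Rightarrow> ('i \<Rightarrow> 'a pair_pre_digraph) \<Rightarrow> ('i \<times> 'a) pair_pre_digraph" where
  "disjoint_UNION I G = \<lparr> pverts = (SIGMA i:I. pverts (G i)),
     parcs = {((i, u), (j, v)). i \<in> I \<and> i = j \<and> (u, v) \<in> parcs (G i)} \<rparr>"

definition copies :: "nat \<Rightarrow> 'a pair_pre_digraph \<Rightarrow> (nat \<times> 'a) pair_pre_digraph" where
  "copies k G = disjoint_UNION {1..k} (\<lambda>_. G)"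

text \<open>The truncated subtraction \<open>n - h\<close> is only meaningful for \<open>h \<le> n\<close>.\<close>

definition S_graph :: "nat \<Rightarrow> nat \<Rightarrow> (nat + nat) pair_pre_digraph" where
  "S_graph n h = graph_join (complete_graph h) (complement_graph (complete_graph (n - h)))"

definition L_graph :: "nat \<Rightarrow> nat \<Rightarrow> (nat + nat \<times> nat) pair_pre_digraph" where
  "L_graph t h = graph_join (complete_graph 1) (copies t (complete_graph h))"

text \<open>Equality of graphs is understood up to isomorphism, and so is containment as a subgraph.\<close>

definition graph_iso :: "'a pair_pre_digraph \<Rightarrow> 'b pair_pre_digraph \<Rightarrow> bool" where
  "graph_iso G H \<longleftrightarrow> digraph_iso (with_proj G) (with_proj H)"

definition contained_in :: "'a pair_pre_digraph \<Rightarrow> 'b pair_pre_digraph \<Rightarrow> bool" where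
  "contained_in H G \<longleftrightarrow>
     (\<exists>H' :: 'b pair_pre_digraph. subgraph (with_proj H') (with_proj G) \<and> graph_iso H H')"

end

theory Submission
  imports Defs
begin

text \<open>
  The forest \<open>F\<close> has \<open>2 * h + 2\<close> vertices, so it is contained in every path on at least that many.  The
  question is thus which connected graphs of minimum degree at least \<open>h\<close> and order at least
  \<open>2 * h + 2\<close> have no path on \<open>2 * h + 2\<close> vertices, and which of them contain \<open>F\<close> nevertheless.

  In such a graph take a longest path, with vertices \<open>x\<^sub>0, x\<^sub>1, \<dots>\<close>.  It misses a vertex, so by
  connectivity its vertices carry no Hamiltonian cycle; hence \<open>x\<^sub>0\<close> is not adjacent to
  \<open>x\<^sub>i\<^sub>+\<^sub>1\<close> when the last vertex is adjacent to \<open>x\<^sub>i\<close>.  Counting neighbours, the path has exactly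
  \<open>2 * h + 1\<close> vertices, and for every \<open>i < 2 * h\<close> exactly one of the two adjacencies holds
  (\<open>longest_path_ends\<close>).  There are two cases.

  Suppose that \<open>x\<^sub>0\<close> is adjacent to \<open>x\<^sub>i\<^sub>+\<^sub>2\<close> and the last vertex to \<open>x\<^sub>i\<close>, for some longest path and
  some \<open>i\<close>.  Then there is a cycle of length \<open>2 * h\<close>.  Nothing longer than a single vertex can hang
  off it, two outside vertices cannot attach to consecutive vertices of it, and counting forces all
  outside vertices to attach to the same alternate vertices of the cycle.  Exchanging the remaining
  cycle vertices with outside ones shows that they are also adjacent to those \<open>h\<close> vertices only, so
  that \<open>G \<subseteq> S\<^sub>n\<^sub>,\<^sub>h\<close> (\<open>closed_path_independent_complement\<close>).

  Suppose that there is no cycle of length \<open>2 * h\<close>, so that no longest path has such a crossing.  Then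
  \<open>x\<^sub>0\<close> is adjacent exactly to \<open>x\<^sub>1, \<dots>, x\<^sub>h\<close>; reversing initial segments, the vertices before the
  middle \<open>x\<^sub>h\<close> form a clique joined to \<open>x\<^sub>h\<close> and to nothing else.  The same holds after the
  middle.  Every neighbour of \<open>x\<^sub>h\<close> lies on a longest path with the same middle, and so by
  connectivity \<open>G = L\<^sub>t\<^sub>,\<^sub>h\<close> with centre \<open>x\<^sub>h\<close> (\<open>windmill_centre_middle\<close>, \<open>windmill_graph_iso\<close>).
  The order gives \<open>t \<ge> 3\<close>.  If \<open>2 * a k \<le> h\<close>, the last component of \<open>F\<close> fits into a third blade and
  the others fit on a longest path (\<open>path_in_third_blade\<close>, \<open>linear_forest_contained_in\<close>).
  Otherwise the shortest component has at least half of the vertices of \<open>F\<close>, so \<open>F\<close> consists of two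
  paths of the same order.
\<close>

section \<open>Paths and cycles as lists of vertices\<close>

definition simple_path :: "'a pair_pre_digraph \<Rightarrow> 'a list \<Rightarrow> bool" where
  "simple_path G xs \<longleftrightarrow> xs \<noteq> [] \<and> distinct xs \<and> set xs \<subseteq> pverts G
     \<and> successively (\<lambda>x y. (x, y) \<in> parcs G) xs"

text \<open>
  A single edge, read as a sequence of two vertices, counts as closed.  Cycles of length \<open>2 * h\<close>
  occur below, and this convention lets the case \<open>h = 1\<close> share the argument of the general case.
\<close>

definition closed_path :: "'a pair_pre_digraph \<Rightarrow> 'a list \<Rightarrow> bool" where
  "closed_path G xs \<longleftrightarrow> simple_path G xs \<and> (last xs, hd xs) \<in> parcs G"

definition neighbours :: "'a pair_pre_digraph \<Rightarrow> 'a \<Rightarrow> 'a set" where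
  "neighbours G x = {y. (x, y) \<in> parcs G}"

lemma simple_path_append_iff:
  "simple_path G (xs @ ys) \<longleftrightarrow>
     (if xs = [] then simple_path G ys else if ys = [] then simple_path G xs
      else simple_path G xs \<and> simple_path G ys \<and> (last xs, hd ys) \<in> parcs G
        \<and> set xs \<inter> set ys = {})"
  by (auto simp: simple_path_def successively_append_iff)

lemma simple_path_singleton: "simple_path G [x] \<longleftrightarrow> x \<in> pverts G"
  by (simp add: simple_path_def)

lemma simple_path_Cons:
  "xs \<noteq> [] \<Longrightarrow> simple_path G (x # xs) \<longleftrightarrow>
     simple_path G xs \<and> x \<in> pverts G \<and> (x, hd xs) \<in> parcs G \<and> x \<notin> set xs"
  by (auto simp: simple_path_def successively_Cons)

lemma simple_path_take: "simple_path G xs \<Longrightarrow> 0 < m \<Longrightarrow> simple_path G (take m xs)"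
  using simple_path_append_iff[of G "take m xs" "drop m xs"]
  by (auto simp: simple_path_def split: if_splits)

lemma simple_path_drop: "simple_path G xs \<Longrightarrow> m < length xs \<Longrightarrow> simple_path G (drop m xs)"
  using simple_path_append_iff[of G "take m xs" "drop m xs"]
  by (auto split: if_splits)

lemma simple_path_nth:
  "simple_path G xs \<Longrightarrow> Suc i < length xs \<Longrightarrow> (xs ! i, xs ! Suc i) \<in> parcs G"
  by (auto simp: simple_path_def dest: successively_nth)

lemma (in pair_graph) simple_path_rev [simp]: "simple_path G (rev xs) \<longleftrightarrow> simple_path G xs"
proof -
  have "successively (\<lambda>x y. (y, x) \<in> parcs G) xs = successively (\<lambda>x y. (x, y) \<in> parcs G) xs"
    by (rule successively_cong) (auto dest: arcs_symmetric)
  then show ?thesis by (simp add: simple_path_def)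
qed

lemma (in pair_graph) finite_neighbours [simp]: "finite (neighbours G x)"
proof (rule finite_subset)
  show "neighbours G x \<subseteq> pverts G" by (auto simp: neighbours_def dest: in_arcsD2)
qed (rule pair_finite_verts)

lemma (in pair_graph) card_neighbours: "card (neighbours G x) = out_degree (with_proj G) x"
proof -
  have "out_arcs (with_proj G) x = Pair x ` neighbours G x"
    by (auto simp: neighbours_def out_arcs_def)
  then have "card (out_arcs (with_proj G) x) = card (neighbours G x)"
    by (simp add: card_image inj_on_def)
  then show ?thesis by (simp add: out_degree_def)
qed

lemma closed_path_swap: "closed_path G (as @ bs) \<Longrightarrow> closed_path G (bs @ as)"
  by (auto simp: closed_path_def simple_path_append_iff split: if_splits)

lemma closed_path_rotate_last:
  assumes "closed_path G xs" "u \<in> set xs"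
  obtains ys where "closed_path G ys" "set ys = set xs" "length ys = length xs" "last ys = u"
proof -
  obtain as bs where xs: "xs = (as @ [u]) @ bs" using split_list[OF assms(2)] by auto
  show ?thesis using that[of "bs @ as @ [u]"] closed_path_swap[of G "as @ [u]" bs] assms(1) xs by auto
qed

lemma closed_path_rotate_hd:
  assumes "closed_path G xs" "u \<in> set xs"
  obtains ys where "closed_path G ys" "set ys = set xs" "length ys = length xs" "hd ys = u"
proof -
  obtain as bs where xs: "xs = as @ u # bs" using split_list[OF assms(2)] by auto
  show ?thesis using that[of "(u # bs) @ as"] closed_path_swap[of G as "u # bs"] assms(1) xs by auto
qed

section \<open>Ends of longest paths\<close>

text \<open>
  The hypotheses of the extremal problem for the path on \<open>2 * h + 2\<close> vertices.
\<close>

locale connected_min_degree_graph = pair_graph G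
  for G :: "'a pair_pre_digraph" +
  fixes h :: nat
  assumes connected: "Digraph_Component.connected (with_proj G)"
    and h_pos: "1 \<le> h"
    and order: "2 * h + 2 \<le> card (pverts G)"
    and degree: "x \<in> pverts G \<Longrightarrow> h \<le> card (neighbours G x)"
begin

lemma edge_leaving:
  assumes "S \<subseteq> pverts G" "S \<noteq> {}" "S \<noteq> pverts G"
  obtains u w where "(u, w) \<in> parcs G" "u \<in> S" "w \<notin> S"
proof -
  obtain s v where sv: "s \<in> S" "v \<in> pverts G" "v \<notin> S" using assms by blast
  have "strongly_connected (with_proj G)"
    using symmetric_connected_imp_strongly_connected[OF pair_sym_arcs connected] .
  then have "s \<rightarrow>\<^sup>*\<^bsub>G\<^esub> v" using sv assms(1) by (auto simp: strongly_connected_def)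
  then have "v \<notin> S \<Longrightarrow> \<exists>u w. (u, w) \<in> parcs G \<and> u \<in> S \<and> w \<notin> S"
  proof (induct rule: reachable_induct)
    case base
    then show ?case using sv by simp
  next
    case (step x y)
    then show ?case by auto
  qed
  then show ?thesis using sv that by blast
qed

text \<open>
  Opening a cycle at a vertex with a neighbour outside gives a longer path.  By connectivity, a
  longest path that misses some vertex can therefore not be closed up into a cycle.
\<close>

lemma closed_path_extend:
  assumes "closed_path G xs" "length xs < card (pverts G)"
  obtains ys where "simple_path G ys" "length ys = Suc (length xs)"
proof -
  have xs: "distinct xs" "xs \<noteq> []" "set xs \<subseteq> pverts G"
    using assms by (auto simp: closed_path_def simple_path_def)
  then have "set xs \<noteq> pverts G" using assms(2) distinct_card[of xs] by auto
  then obtain u w where uw: "(u, w) \<in> parcs G" "u \<in> set xs" "w \<notin> set xs"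
    using edge_leaving[of "set xs"] xs by auto
  obtain ys where ys: "closed_path G ys" "set ys = set xs" "length ys = length xs" "last ys = u"
    using closed_path_rotate_last[OF assms(1) uw(2)] .
  have "simple_path G (ys @ [w])"
    using ys uw by (auto simp: simple_path_append_iff simple_path_singleton closed_path_def
        dest: in_arcsD2)
  then show ?thesis using that[of "ys @ [w]"] ys by simp
qed

end

locale no_long_path_graph = connected_min_degree_graph +
  assumes no_long_path: "simple_path G xs \<Longrightarrow> length xs \<le> 2 * h + 1"
begin

text \<open>
  If the first vertex is joined to position \<open>i + 1\<close> and the last one to position \<open>i\<close>, then the
  path runs to position \<open>i\<close>, jumps to its last vertex, returns to position \<open>i + 1\<close> and closes up:
  a cycle on all its vertices, which extends to a longer path.
\<close>

lemma no_closing_rotation: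
  assumes "simple_path G xs" "\<And>ys. simple_path G ys \<Longrightarrow> length ys \<le> length xs"
    and "Suc i < length xs" "(hd xs, xs ! Suc i) \<in> parcs G"
  shows "(last xs, xs ! i) \<notin> parcs G"
proof
  assume "(last xs, xs ! i) \<in> parcs G"
  define as bs where "as = take (Suc i) xs" and "bs = drop (Suc i) xs"
  have xs: "xs = as @ bs" by (simp add: as_def bs_def)
  have ne: "as \<noteq> []" "bs \<noteq> []" using assms(3) by (auto simp: as_def bs_def)
  have las: "last as = xs ! i" using assms(3)
    by (simp add: as_def take_Suc_conv_app_nth)
  have hbs: "hd bs = xs ! Suc i" using assms(3) by (simp add: bs_def hd_drop_conv_nth)
  have "(last as, last bs) \<in> parcs G" "(hd bs, hd as) \<in> parcs G"
    using \<open>(last xs, xs ! i) \<in> parcs G\<close> assms(4) las hbs ne xs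
    by (auto dest: arcs_symmetric)
  then have "closed_path G (as @ rev bs)"
    using assms(1) ne unfolding closed_path_def xs
    by (auto simp: simple_path_append_iff hd_rev last_rev)
  moreover have "length xs < card (pverts G)" using no_long_path[OF assms(1)] order by simp
  ultimately obtain ys where "simple_path G ys" "length ys = Suc (length (as @ rev bs))"
    by (metis closed_path_extend length_append length_rev xs)
  then show False using assms(2)[of ys] xs by simp
qed

lemma hd_neighbours_indices:
  assumes "simple_path G xs" "neighbours G (hd xs) \<subseteq> set xs"
  shows "bij_betw (\<lambda>i. xs ! Suc i) {i. Suc i < length xs \<and> (hd xs, xs ! Suc i) \<in> parcs G}
    (neighbours G (hd xs))"
proof (rule bij_betw_imageI)
  have d: "distinct xs" "xs \<noteq> []" using assms(1) by (auto simp: simple_path_def)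
  then show "inj_on (\<lambda>i. xs ! Suc i) {i. Suc i < length xs \<and> (hd xs, xs ! Suc i) \<in> parcs G}"
    by (auto simp: inj_on_def nth_eq_iff_index_eq)
  show "(\<lambda>i. xs ! Suc i) ` {i. Suc i < length xs \<and> (hd xs, xs ! Suc i) \<in> parcs G}
    = neighbours G (hd xs)"
  proof (intro equalityI subsetI)
    fix y assume y: "y \<in> neighbours G (hd xs)"
    then obtain j where j: "j < length xs" "y = xs ! j"
      using assms(2) by (metis in_set_conv_nth subsetD)
    have "j \<noteq> 0" using y j d no_loops'[of "xs ! 0" "xs ! j"]
      by (intro notI) (auto simp: neighbours_def hd_conv_nth)
    then obtain i where "j = Suc i" by (cases j) auto
    then show "y \<in> (\<lambda>i. xs ! Suc i) ` {i. Suc i < length xs \<and> (hd xs, xs ! Suc i) \<in> parcs G}"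
      using y j by (auto simp: neighbours_def)
  qed (auto simp: neighbours_def)
qed

lemma last_neighbours_indices:
  assumes "simple_path G xs" "neighbours G (last xs) \<subseteq> set xs"
  shows "bij_betw (\<lambda>i. xs ! i) {i. Suc i < length xs \<and> (last xs, xs ! i) \<in> parcs G}
    (neighbours G (last xs))"
proof (rule bij_betw_imageI)
  have d: "distinct xs" "xs \<noteq> []" using assms(1) by (auto simp: simple_path_def)
  then show "inj_on (\<lambda>i. xs ! i) {i. Suc i < length xs \<and> (last xs, xs ! i) \<in> parcs G}"
    by (auto simp: inj_on_def nth_eq_iff_index_eq)
  show "(\<lambda>i. xs ! i) ` {i. Suc i < length xs \<and> (last xs, xs ! i) \<in> parcs G}
    = neighbours G (last xs)"
  proof (intro equalityI subsetI)
    fix y assume y: "y \<in> neighbours G (last xs)"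
    then obtain j where j: "j < length xs" "y = xs ! j"
      using assms(2) by (metis in_set_conv_nth subsetD)
    have "j \<noteq> length xs - 1" using y j d no_loops' by (auto simp: neighbours_def last_conv_nth)
    then have "Suc j < length xs" using j(1) by linarith
    then show "y \<in> (\<lambda>i. xs ! i) ` {i. Suc i < length xs \<and> (last xs, xs ! i) \<in> parcs G}"
      using y j by (auto simp: neighbours_def)
  qed (auto simp: neighbours_def)
qed

lemma longest_path_hd_neighbours:
  assumes xs: "simple_path G xs" and longest: "\<And>ys. simple_path G ys \<Longrightarrow> length ys \<le> length xs"
  shows "neighbours G (hd xs) \<subseteq> set xs"
proof (rule subsetI, rule ccontr)
  fix y assume "y \<in> neighbours G (hd xs)" "y \<notin> set xs"
  then have "simple_path G (y # xs)"
    using xs by (subst simple_path_Cons)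
      (auto simp: simple_path_def neighbours_def dest: in_arcsD2 arcs_symmetric)
  then show False using longest[of "y # xs"] by simp
qed

text \<open>
  The sets \<open>A\<close> and \<open>B\<close> collect the neighbours of the two ends, those of the first vertex shifted
  down by one.  They are disjoint subsets of the positions before the last, and each has at
  least \<open>h\<close> elements.  As the path has at most \<open>2 * h + 1\<close> vertices, there is no slack: the two sets
  partition those positions.
\<close>

lemma longest_path_ends:
  assumes xs: "simple_path G xs" and longest: "\<And>ys. simple_path G ys \<Longrightarrow> length ys \<le> length xs"
  defines "A \<equiv> {i. Suc i < length xs \<and> (hd xs, xs ! Suc i) \<in> parcs G}"
    and "B \<equiv> {i. Suc i < length xs \<and> (last xs, xs ! i) \<in> parcs G}"
  shows "length xs = 2 * h + 1" "card A = h" "A \<inter> B = {}" "A \<union> B = {..<2 * h}"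
proof -
  have ne: "xs \<noteq> []" "set xs \<subseteq> pverts G" using xs by (auto simp: simple_path_def)
  have "neighbours G (hd xs) \<subseteq> set xs"
    using longest_path_hd_neighbours[OF xs longest] .
  from bij_betw_same_card[OF hd_neighbours_indices[OF xs this]]
  have A: "h \<le> card A" using degree[OF subsetD[OF ne(2) hd_in_set[OF ne(1)]]] unfolding A_def by simp
  have "neighbours G (last xs) \<subseteq> set xs"
    using longest_path_hd_neighbours[of "rev xs"] xs ne(1) longest by (simp add: hd_rev)
  from bij_betw_same_card[OF last_neighbours_indices[OF xs this]]
  have B: "h \<le> card B" using degree[OF subsetD[OF ne(2) last_in_set[OF ne(1)]]] unfolding B_def by simp
  show AB: "A \<inter> B = {}"
    using no_closing_rotation[OF xs longest] unfolding A_def B_def by blast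
  have sub: "A \<union> B \<subseteq> {..<length xs - 1}" by (auto simp: A_def B_def)
  then have fin: "finite A" "finite B" by (auto intro: finite_subset)
  have "card A + card B = card (A \<union> B)" using AB fin by (simp add: card_Un_disjoint)
  also have "\<dots> \<le> length xs - 1" using card_mono[OF _ sub] by simp
  finally have le: "card A + card B \<le> length xs - 1" .
  then show len: "length xs = 2 * h + 1" and cA: "card A = h"
    using A B no_long_path[OF xs] ne(1) h_pos by auto
  have cB: "card B = h" using A B le len by simp
  show "A \<union> B = {..<2 * h}"
  proof (rule card_subset_eq)
    show "A \<union> B \<subseteq> {..<2 * h}" using sub len by simp
    show "card (A \<union> B) = card {..<2 * h}"
      using AB fin cA cB by (simp add: card_Un_disjoint)
  qed simp
qed

lemma ex_path_length:
  obtains xs where "simple_path G xs" "length xs = 2 * h + 1"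
proof -
  obtain x where "x \<in> pverts G" using order by fastforce
  then have "simple_path G [x]" by (simp add: simple_path_singleton)
  from ex_has_greatest_nat[of "simple_path G", OF this, of length "2 * h + 2"]
  obtain xs where "simple_path G xs" "\<And>ys. simple_path G ys \<Longrightarrow> length ys \<le> length xs"
    using no_long_path by fastforce
  then show ?thesis using that longest_path_ends(1) by blast
qed

section \<open>Cycles of twice the minimum degree\<close>

text \<open>
  An edge outside a cycle of length \<open>2 * h\<close> could, by connectivity, be taken with an end
  adjacent to the cycle; opening the cycle there gives a path on \<open>2 * h + 2\<close> vertices.
\<close>

lemma closed_path_no_ears:
  assumes "closed_path G xs" "length xs = 2 * h" "x \<in> pverts G - set xs"
  shows "neighbours G x \<subseteq> set xs"
proof -
  \<comment> \<open>\<open>T\<close> has no edge leaving it, hence is everything\<close>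
  define T where "T = set xs \<union> {x \<in> pverts G. neighbours G x \<subseteq> set xs}"
  have xs: "set xs \<subseteq> pverts G" "xs \<noteq> []" using assms(1) by (auto simp: closed_path_def simple_path_def)
  have "T = pverts G"
  proof (rule ccontr)
    assume "T \<noteq> pverts G"
    then obtain u w where uw: "(u, w) \<in> parcs G" "u \<in> T" "w \<notin> T"
      using edge_leaving[of T] xs by (auto simp: T_def)
    then obtain z where z: "(w, z) \<in> parcs G" "z \<notin> set xs" "w \<notin> set xs"
      by (auto simp: T_def neighbours_def dest: in_arcsD2)
    then have "u \<in> set xs" using uw by (auto simp: T_def neighbours_def)
    then obtain ys where ys: "closed_path G ys" "set ys = set xs" "length ys = length xs" "last ys = u"
      using closed_path_rotate_last[OF assms(1)] by blast
    have "simple_path G (ys @ [w, z])"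
      using ys z uw no_loops' by (auto simp: simple_path_append_iff simple_path_Cons closed_path_def
          simple_path_singleton dest: in_arcsD2)
    then show False using no_long_path[of "ys @ [w, z]"] ys assms(2) by simp
  qed
  then show ?thesis using assms(3) by (auto simp: T_def)
qed

text \<open>
  Here the rotation that would close up the whole path leaves out exactly the vertex at
  position \<open>i + 1\<close>.
\<close>

lemma crossing_closed_path:
  assumes xs: "simple_path G xs" "length xs = 2 * h + 1"
    and i: "Suc (Suc i) < length xs" "(last xs, xs ! i) \<in> parcs G" "(hd xs, xs ! Suc (Suc i)) \<in> parcs G"
  obtains cs where "closed_path G cs" "length cs = 2 * h"
proof -
  define as bs where "as = take (Suc i) xs" and "bs = drop (Suc (Suc i)) xs"
  have split: "xs = (as @ [xs ! Suc i]) @ bs"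
    using i(1) by (metis as_def bs_def append_take_drop_id take_Suc_conv_app_nth Suc_lessD)
  have ne: "as \<noteq> []" "bs \<noteq> []" using i(1) by (auto simp: as_def bs_def)
  have "last as = xs ! i" using i(1) by (simp add: as_def take_Suc_conv_app_nth)
  moreover have "hd bs = xs ! Suc (Suc i)" using i(1) by (simp add: bs_def hd_drop_conv_nth)
  moreover have "last xs = last bs" "hd xs = hd as"
    using ne arg_cong[OF split, of last] arg_cong[OF split, of hd] by simp_all
  ultimately have e: "(last as, last bs) \<in> parcs G" "(hd bs, hd as) \<in> parcs G"
    using i(2,3) arcs_symmetric by auto
  have "simple_path G as" "simple_path G bs" "set as \<inter> set bs = {}"
    using xs(1) ne arg_cong[OF split, of "simple_path G"] by (auto simp: simple_path_append_iff simple_path_Cons)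
  then have "closed_path G (as @ rev bs)"
    using ne e by (auto simp: closed_path_def simple_path_append_iff hd_rev last_rev)
  moreover have "length (as @ rev bs) = 2 * h"
    using xs(2) i(1) by (simp add: as_def bs_def)
  ultimately show ?thesis by (rule that)
qed

text \<open>
  Otherwise the cycle, opened between the two consecutive vertices, extends at both ends.
\<close>

lemma no_consecutive_attachments:
  assumes cs: "closed_path G cs" "length cs = 2 * h"
    and xy: "x \<in> pverts G - set cs" "y \<in> pverts G - set cs" "x \<noteq> y"
    and i: "i < 2 * h" "(x, cs ! i) \<in> parcs G"
  shows "(y, cs ! (Suc i mod (2 * h))) \<notin> parcs G"
proof
  assume y: "(y, cs ! (Suc i mod (2 * h))) \<in> parcs G"
  \<comment> \<open>the cycle opened between positions \<open>i\<close> and \<open>i + 1\<close>\<close>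
  define ds where "ds = drop (Suc i) cs @ take (Suc i) cs"
  have "closed_path G ds"
    using closed_path_swap[of G "take (Suc i) cs" "drop (Suc i) cs"] cs(1) by (simp add: ds_def)
  moreover have "set ds = set cs"
    unfolding ds_def by (metis append_take_drop_id set_append sup_commute)
  moreover have "length ds = 2 * h" using cs(2) i(1) by (simp add: ds_def)
  ultimately have ds: "closed_path G ds" "set ds = set cs" "length ds = 2 * h" "ds \<noteq> []"
    using h_pos by auto
  have "last ds = cs ! i" using i(1) cs(2) by (simp add: ds_def take_Suc_conv_app_nth)
  moreover have "hd ds = cs ! (Suc i mod (2 * h))"
  proof (cases "Suc i = 2 * h")
    case True
    moreover have "cs \<noteq> []" using cs(2) h_pos by auto
    ultimately show ?thesis using cs(2) by (simp add: ds_def hd_conv_nth)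
  next
    case False
    then show ?thesis using cs(2) i(1) by (simp add: ds_def hd_append hd_drop_conv_nth)
  qed
  ultimately have "simple_path G (y # ds @ [x])"
    using ds xy i(2) y arcs_symmetric
    by (auto simp: simple_path_Cons simple_path_append_iff simple_path_singleton closed_path_def)
  then show False using no_long_path[of "y # ds @ [x]"] ds by simp
qed

text \<open>
  The positions \<open>N x\<close> and the successors of \<open>N y\<close> are disjoint in a cyclic order of size
  \<open>2 * h\<close>, and both have at least \<open>h\<close> elements, so they are complementary; the same holds with \<open>x\<close>
  and \<open>y\<close> exchanged.  Hence \<open>N x\<close> is invariant under a shift by two, and being of size \<open>h\<close> it is
  one parity class.
\<close>

lemma attachments_alternate:
  assumes cs: "closed_path G cs" "length cs = 2 * h"
    and xy: "x \<in> pverts G - set cs" "y \<in> pverts G - set cs" "x \<noteq> y"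
    and x0: "(x, cs ! 0) \<in> parcs G"
  shows "neighbours G x = (\<lambda>j. cs ! (2 * j)) ` {..<h}"
    and "neighbours G y = (\<lambda>j. cs ! (2 * j)) ` {..<h}"
proof -
  define N where "N z = {i. i < 2 * h \<and> (z, cs ! i) \<in> parcs G}" for z
  define s where "s i = Suc i mod (2 * h)" for i
  have img: "neighbours G z = (\<lambda>i. cs ! i) ` N z" if "z \<in> pverts G - set cs" for z
    using closed_path_no_ears[OF cs that] cs(2)
    by (fastforce simp: N_def neighbours_def in_set_conv_nth)
  have card: "h \<le> card (N z)" if "z \<in> pverts G - set cs" for z
  proof -
    have "card (neighbours G z) \<le> card (N z)"
      unfolding img[OF that] by (rule card_image_le) (simp add: N_def)
    then show ?thesis using degree[of z] that by simp
  qed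
  have inj: "inj_on s {..<2 * h}"
  proof (rule inj_onI)
    fix i j assume "i \<in> {..<2 * h}" "j \<in> {..<2 * h}" "s i = s j"
    then show "i = j" by (cases "Suc i = 2 * h"; cases "Suc j = 2 * h") (auto simp: s_def)
  qed
  have shift: "s i \<in> N u \<longleftrightarrow> i \<notin> N v" "card (N u) = h"
    if uv: "u \<in> pverts G - set cs" "v \<in> pverts G - set cs" "u \<noteq> v" and i: "i < 2 * h" for u v i
  proof -
    have sub: "N u \<subseteq> {..<2 * h}" "N v \<subseteq> {..<2 * h}" "s ` N v \<subseteq> {..<2 * h}"
      using h_pos by (auto simp: N_def s_def)
    then have fin: "finite (N u)" "finite (s ` N v)" by (auto intro: finite_subset)
    have disj: "N u \<inter> s ` N v = {}"
      using no_consecutive_attachments[OF cs uv(2,1)] uv(3) by (auto simp: N_def s_def)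
    have cv: "card (s ` N v) = card (N v)"
      using inj sub(2) by (intro card_image) (rule inj_on_subset)
    have le: "card (N u) + card (N v) \<le> 2 * h"
      using card_mono[of "{..<2 * h}" "N u \<union> s ` N v"] sub fin disj cv
      by (simp add: card_Un_disjoint)
    then show "card (N u) = h" using card[OF uv(1)] card[OF uv(2)] by simp
    have "N u \<union> s ` N v = {..<2 * h}"
      using sub fin disj cv le card[OF uv(1)] card[OF uv(2)]
      by (intro card_subset_eq) (auto simp: card_Un_disjoint)
    moreover have "s i \<in> {..<2 * h}" using h_pos by (simp add: s_def)
    moreover have "s i \<in> s ` N v \<longleftrightarrow> i \<in> N v"
      using inj sub(2) i by (auto simp: inj_on_def)
    ultimately show "s i \<in> N u \<longleftrightarrow> i \<notin> N v" using disj by blast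
  qed
  define E where "E = (\<lambda>j. 2 * j) ` {..<h}"
  \<comment> \<open>two shifts lead from \<open>N x\<close> to the complement of \<open>N y\<close> and back to \<open>N x\<close>\<close>
  have "2 * j \<in> N x" if "j < h" for j
    using that
  proof (induct j)
    case 0
    then show ?case using x0 h_pos by (simp add: N_def)
  next
    case (Suc j)
    then have "s (2 * j) \<notin> N y"
      using shift(1)[OF xy(2,1) xy(3)[symmetric], of "2 * j"] by simp
    moreover have "s (2 * j) = Suc (2 * j)" "s (Suc (2 * j)) = 2 * Suc j"
      using Suc.prems by (auto simp: s_def)
    ultimately show ?case using shift(1)[OF xy, of "Suc (2 * j)"] Suc.prems by simp
  qed
  then have "E \<subseteq> N x" by (auto simp: E_def)
  moreover have "card E = h" unfolding E_def by (subst card_image) (auto simp: inj_on_def)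
  moreover have "finite (N x)" by (simp add: N_def)
  ultimately have Nx: "N x = E"
    using shift(2)[OF xy, of 0] h_pos card_subset_eq[of "N x" E] by auto
  have "i \<in> N y \<longleftrightarrow> i \<in> E" if i: "i < 2 * h" for i
  proof -
    have E_iff: "j \<in> E \<longleftrightarrow> even j" if "j < 2 * h" for j
      using that by (auto simp: E_def elim!: evenE)
    have lt: "s i < 2 * h" using h_pos by (simp add: s_def)
    have "even (s i) \<longleftrightarrow> odd i"
      using i by (cases "Suc i = 2 * h") (auto simp: s_def, presburger+)
    then show ?thesis using shift(1)[OF xy i] Nx E_iff[OF i] E_iff[OF lt] by simp
  qed
  moreover have "E \<subseteq> {..<2 * h}" by (auto simp: E_def)
  ultimately have Ny: "N y = E" by (auto simp: N_def)
  show "neighbours G x = (\<lambda>j. cs ! (2 * j)) ` {..<h}" "neighbours G y = (\<lambda>j. cs ! (2 * j)) ` {..<h}"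
    using img[OF xy(1)] img[OF xy(2)] Nx Ny by (simp_all add: E_def image_image)
qed

lemma closed_path_replace:
  assumes "closed_path G (as @ c # bs)" "as \<noteq> []"
    and "x \<in> pverts G" "x \<notin> set (as @ c # bs)"
    and "(last as, x) \<in> parcs G" "(x, hd (bs @ as)) \<in> parcs G"
  shows "closed_path G (as @ x # bs)"
  using assms
  by (cases "bs = []") (auto simp: closed_path_def simple_path_append_iff simple_path_singleton
      simple_path_Cons)

text \<open>
  All vertices off the cycle have the same neighbourhood \<open>S\<close>, namely the even positions.  An odd
  position is no different: exchanging its vertex with an outside vertex \<open>x\<close> gives another cycle of
  length \<open>2 * h\<close> with the same even positions, and now the odd vertex lies outside.  The second
  outside vertex \<open>y\<close>, which exists by the bound on the order, is what pins down its neighbourhood.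
\<close>

lemma closed_path_independent_complement:
  assumes "closed_path G cs" "length cs = 2 * h"
  obtains S where "S \<subseteq> pverts G" "card S = h" "\<And>x. x \<in> pverts G - S \<Longrightarrow> neighbours G x \<subseteq> S"
proof -
  have "card (set cs) = 2 * h" "set cs \<subseteq> pverts G"
    using assms by (auto simp: closed_path_def simple_path_def distinct_card)
  then have two: "2 \<le> card (pverts G - set cs)"
    using order by (simp add: card_Diff_subset)
  then have "pverts G - set cs \<noteq> {}" by force
  then obtain x where x: "x \<in> pverts G - set cs" by blast
  have "neighbours G x \<noteq> {}" using degree[of x] x h_pos by auto
  then obtain u where u: "(x, u) \<in> parcs G" "u \<in> set cs"
    using closed_path_no_ears[OF assms x] by (auto simp: neighbours_def)
  obtain ds where ds: "closed_path G ds" "set ds = set cs" "length ds = 2 * h" "hd ds = u"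
    using closed_path_rotate_hd[OF assms(1) u(2)] assms(2) by metis
  have d: "distinct ds" "ds \<noteq> []" "set ds \<subseteq> pverts G"
    using ds(1) by (auto simp: closed_path_def simple_path_def)
  have u0: "ds ! 0 = u" using ds(4) d(2) by (simp add: hd_conv_nth)
  define S where "S = (\<lambda>j. ds ! (2 * j)) ` {..<h}"
  have "\<not> pverts G - set cs \<subseteq> {x}"
    using two card_mono[of "{x}" "pverts G - set cs"] by auto
  then obtain y where y: "y \<in> pverts G - set ds" "x \<noteq> y" using ds(2) by auto
  note x = x[folded ds(2)]
  have Nx: "neighbours G x = S" and Ny: "neighbours G y = S"
    using attachments_alternate[OF ds(1,3) x y] u u0 by (auto simp: S_def)
  have outside: "neighbours G z = S" if "z \<in> pverts G - set ds" for z
    using attachments_alternate(2)[OF ds(1,3) x that] u u0 Nx by (cases "x = z") (auto simp: S_def)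
  have odd: "neighbours G (ds ! i) = S" if i: "i < 2 * h" "odd i" for i
  proof -
    define as bs where "as = take i ds" and "bs = drop (Suc i) ds"
    have split: "ds = as @ ds ! i # bs" using i ds(3) by (simp add: as_def bs_def id_take_nth_drop[symmetric])
    have "0 < i" using i(2) by (cases i) auto
    have ne: "as \<noteq> []" using \<open>0 < i\<close> d(2) by (auto simp: as_def)
    obtain m where m: "i = Suc (2 * m)" using i(2) by (auto elim: oddE)
    have "last as = ds ! (2 * m)" using m i ds(3) by (simp add: as_def take_Suc_conv_app_nth)
    then have "last as \<in> S" using m i by (auto simp: S_def)
    moreover have "hd (bs @ as) \<in> S"
    proof (cases "bs = []")
      case True
      then have "hd (bs @ as) = ds ! (2 * 0)" using ne \<open>0 < i\<close> d(2) by (simp add: as_def hd_conv_nth)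
      then show ?thesis using h_pos unfolding S_def by (metis imageI lessThan_iff less_eq_Suc_le One_nat_def)
    next
      case False
      then have lt: "2 * Suc m < 2 * h" using m ds(3) by (simp add: bs_def)
      then have "hd (bs @ as) = ds ! (2 * Suc m)" using m ds(3) by (simp add: bs_def hd_append hd_drop_conv_nth)
      then show ?thesis using lt unfolding S_def by (intro image_eqI[of _ _ "Suc m"]) auto
    qed
    ultimately have e: "(last as, x) \<in> parcs G" "(x, hd (bs @ as)) \<in> parcs G"
      using Nx by (auto simp: neighbours_def dest: arcs_symmetric)
    define es where "es = as @ x # bs"
    have "closed_path G es"
      unfolding es_def using closed_path_replace[OF _ ne _ _ e] ds(1) x split by (metis DiffE)
    moreover have "length es = 2 * h" using arg_cong[OF split, of length] ds(3) by (simp add: es_def)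
    moreover have "ds ! i \<in> pverts G - set es"
    proof -
      have "distinct (as @ ds ! i # bs)" using d(1) split by simp
      moreover have "ds ! i \<noteq> x" using x i(1) ds(3) nth_mem by force
      moreover have "ds ! i \<in> pverts G" using d(3) i(1) ds(3) nth_mem by force
      ultimately show ?thesis by (auto simp: es_def)
    qed
    moreover have "y \<in> pverts G - set es"
    proof -
      have "set es \<subseteq> insert x (set ds)" by (subst split) (auto simp: es_def)
      then show ?thesis using y by auto
    qed
    moreover have "y \<noteq> ds ! i" using y i ds(3) by auto
    moreover have es: "es ! j = ds ! j" if "j < 2 * h" "even j" for j
    proof -
      have "j \<noteq> i" using that(2) i(2) by auto
      moreover have "es = ds[i := x]" using i ds(3) by (simp add: es_def as_def bs_def upd_conv_take_nth_drop)
      ultimately show ?thesis by simp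
    qed
    moreover have "(y, es ! 0) \<in> parcs G"
    proof -
      have "ds ! (2 * 0) \<in> S" unfolding S_def using h_pos by (intro imageI) simp
      then show ?thesis using es[of 0] Ny h_pos by (auto simp: neighbours_def)
    qed
    ultimately have "neighbours G (ds ! i) = (\<lambda>j. es ! (2 * j)) ` {..<h}"
      by (intro attachments_alternate(2)[of es y "ds ! i"])
    also have "\<dots> = S" unfolding S_def by (rule image_cong) (auto simp: es)
    finally show ?thesis .
  qed
  show ?thesis
  proof (rule that[of S])
    show "S \<subseteq> pverts G" using d(3) ds(3) by (auto simp: S_def)
    show "card S = h" unfolding S_def
      by (subst card_image) (use d(1) ds(3) in \<open>auto simp: inj_on_def nth_eq_iff_index_eq\<close>)
    fix z assume z: "z \<in> pverts G - S"
    have "neighbours G z = S"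
    proof (cases "z \<in> set ds")
      case True
      then obtain i where i: "i < 2 * h" "z = ds ! i" using ds(3) by (metis in_set_conv_nth)
      have "odd i" using z i by (auto simp: S_def elim!: evenE)
      then show ?thesis using odd i by simp
    next
      case False
      then show ?thesis using outside z by simp
    qed
    then show "neighbours G z \<subseteq> S" by simp
  qed
qed

end

section \<open>Longest paths without crossing: windmills\<close>

definition closed_nbhd :: "'a pair_pre_digraph \<Rightarrow> 'a \<Rightarrow> 'a set" where
  "closed_nbhd G x = insert x (neighbours G x)"

text \<open>
  The intrinsic form of the windmill \<open>K\<^sub>1 \<or> t K\<^sub>h\<close> with centre \<open>c\<close>: the blades, each taken
  together with the centre, are the closed neighbourhoods of the other vertices.
\<close>

definition windmill_centre :: "'a pair_pre_digraph \<Rightarrow> nat \<Rightarrow> 'a \<Rightarrow> bool" where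
  "windmill_centre G h c \<longleftrightarrow> c \<in> pverts G \<and> (\<forall>x \<in> pverts G - {c}.
     c \<in> closed_nbhd G x \<and> card (closed_nbhd G x) = Suc h \<and>
     (\<forall>y \<in> closed_nbhd G x - {c}. closed_nbhd G y = closed_nbhd G x))"

lemma downward_closed_nat_eq_lessThan:
  fixes A :: "nat set"
  assumes "finite A" "\<And>i. Suc i \<in> A \<Longrightarrow> i \<in> A"
  shows "A = {..<card A}"
proof (rule card_subset_eq)
  show "A \<subseteq> {..<card A}"
  proof
    fix a assume a: "a \<in> A"
    have "a - k \<in> A" for k
    proof (induct k)
      case (Suc k)
      then show ?case using assms(2)[of "a - Suc k"] by (cases "k < a") (auto simp: Suc_diff_Suc)
    qed (use a in simp)
    then have "{..a} \<subseteq> A" by (metis atMost_iff diff_diff_cancel subsetI)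
    from card_mono[OF assms(1) this] show "a \<in> {..<card A}" by simp
  qed
qed simp_all

locale no_long_path_no_closed_path_graph = no_long_path_graph +
  assumes no_closed_path: "closed_path G cs \<Longrightarrow> length cs \<noteq> 2 * h"
begin

text \<open>
  Without a cycle of length \<open>2 * h\<close>, the set \<open>B\<close> of positions adjacent to the last vertex is closed
  upwards, since a step out of \<open>B\<close> would be a crossing.  So its complement
  \<open>A\<close> is closed downwards; having \<open>h\<close> elements, it is the initial segment of that length.
\<close>

lemma closed_nbhd_hd:
  assumes xs: "simple_path G xs" "length xs = 2 * h + 1"
  shows "closed_nbhd G (hd xs) = set (take (Suc h) xs)"
proof -
  define A where "A = {i. Suc i < length xs \<and> (hd xs, xs ! Suc i) \<in> parcs G}"
  define B where "B = {i. Suc i < length xs \<and> (last xs, xs ! i) \<in> parcs G}"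
  have ne: "xs \<noteq> []" using xs by auto
  have longest: "length ys \<le> length xs" if "simple_path G ys" for ys
    using no_long_path[OF that] xs(2) by simp
  have AB: "card A = h" "A \<inter> B = {}" "A \<union> B = {..<2 * h}"
    using longest_path_ends[OF xs(1) longest] by (auto simp: A_def B_def)
  have "i \<in> A" if "Suc i \<in> A" for i
  proof (rule ccontr)
    assume "i \<notin> A"
    moreover have "i < 2 * h" using that xs(2) by (simp add: A_def)
    ultimately have "i \<in> B" using AB(3) by auto
    then show False
      using crossing_closed_path[OF xs, of i] that no_closed_path by (auto simp: A_def B_def)
  qed
  moreover have "finite A" by (rule finite_subset[of _ "{..<length xs}"]) (auto simp: A_def)
  ultimately have "A = {..<h}" using downward_closed_nat_eq_lessThan[of A] AB(1) by simp
  then have "neighbours G (hd xs) = (\<lambda>i. xs ! Suc i) ` {..<h}"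
    using hd_neighbours_indices[OF xs(1) longest_path_hd_neighbours[OF xs(1) longest]]
    by (simp add: A_def bij_betw_def)
  then have "closed_nbhd G (hd xs) = (!) xs ` insert 0 (Suc ` {..<h})"
    using ne by (simp add: closed_nbhd_def hd_conv_nth image_image)
  also have "insert 0 (Suc ` {..<h}) = {0..<Suc h}"
    by (simp add: atLeast0LessThan lessThan_Suc_eq_insert_0)
  also have "(!) xs ` {0..<Suc h} = set (take (Suc h) xs)"
    using nth_image[of "Suc h" xs] xs(2) by simp
  finally show ?thesis .
qed

text \<open>
  The first vertex is adjacent to everything up to the middle, so reversing an initial segment
  before the middle gives another longest path, with the same first half and the
  given vertex in front.
\<close>

lemma closed_nbhd_left:
  assumes xs: "simple_path G xs" "length xs = 2 * h + 1" and x: "x \<in> set (take h xs)"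
  shows "closed_nbhd G x = set (take (Suc h) xs)"
proof -
  obtain i where i: "i < h" "x = xs ! i"
    using x xs(2) by (auto simp: in_set_conv_nth)
  have d: "distinct xs" "xs \<noteq> []" using xs(1) by (auto simp: simple_path_def)
  define as bs where "as = take (Suc i) xs" and "bs = drop (Suc i) xs"
  have split: "xs = as @ bs" by (simp add: as_def bs_def)
  have ne: "as \<noteq> []" "bs \<noteq> []" using i xs(2) by (auto simp: as_def bs_def)
  have "xs ! Suc i \<in> set (take (Suc h) xs)"
    using i(1) xs(2) by (auto simp: in_set_conv_nth intro!: exI[of _ "Suc i"])
  then have "xs ! Suc i \<in> closed_nbhd G (hd xs)" using closed_nbhd_hd[OF xs] by simp
  moreover have "xs ! Suc i \<noteq> hd xs"
    using d i(1) xs(2) by (simp add: hd_conv_nth nth_eq_iff_index_eq)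
  ultimately have e: "(hd as, hd bs) \<in> parcs G"
    using i(1) xs(2) by (auto simp: closed_nbhd_def neighbours_def as_def bs_def hd_drop_conv_nth)
  have "simple_path G as" "simple_path G bs" "set as \<inter> set bs = {}"
    using xs(1) ne arg_cong[OF split, of "simple_path G"] by (auto simp: simple_path_append_iff)
  then have "simple_path G (rev as @ bs)"
    using ne e by (auto simp: simple_path_append_iff last_rev)
  moreover have "length (rev as @ bs) = 2 * h + 1" using xs(2) i(1) by (simp add: as_def bs_def)
  ultimately have "closed_nbhd G (hd (rev as @ bs)) = set (take (Suc h) (rev as @ bs))"
    by (rule closed_nbhd_hd)
  moreover have "hd (rev as @ bs) = x"
    using ne i xs(2) by (simp add: hd_rev as_def take_Suc_conv_app_nth)
  moreover have "length as \<le> Suc h" using i(1) by (simp add: as_def)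
  then have "set (take (Suc h) (rev as @ bs)) = set (take (Suc h) (as @ bs))"
    by simp
  ultimately show ?thesis using split by simp
qed

lemma closed_nbhd_right:
  assumes xs: "simple_path G xs" "length xs = 2 * h + 1" and x: "x \<in> set (drop (Suc h) xs)"
  shows "closed_nbhd G x = set (drop h xs)"
  using closed_nbhd_left[of "rev xs" x] xs x by (simp add: take_rev)

lemma path_vertex_blade:
  assumes xs: "simple_path G xs" "length xs = 2 * h + 1" and x: "x \<in> set xs" "x \<noteq> xs ! h"
  shows "closed_nbhd G x \<subseteq> set xs" "xs ! h \<in> closed_nbhd G x" "card (closed_nbhd G x) = Suc h"
    "y \<in> closed_nbhd G x \<Longrightarrow> y \<noteq> xs ! h \<Longrightarrow> closed_nbhd G y = closed_nbhd G x"
proof -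
  have d: "distinct xs" using xs(1) by (auto simp: simple_path_def)
  have take: "set (take (Suc h) xs) = insert (xs ! h) (set (take h xs))"
    using xs(2) by (simp add: take_Suc_conv_app_nth)
  have drop: "set (drop h xs) = insert (xs ! h) (set (drop (Suc h) xs))"
    by (subst Cons_nth_drop_Suc[symmetric]) (use xs(2) in simp_all)
  have "set xs = set (take (Suc h) xs) \<union> set (drop (Suc h) xs)"
    by (metis append_take_drop_id set_append)
  then consider "x \<in> set (take h xs)" | "x \<in> set (drop (Suc h) xs)" using x take by auto
  then have "closed_nbhd G x \<subseteq> set xs \<and> xs ! h \<in> closed_nbhd G x \<and> card (closed_nbhd G x) = Suc h
    \<and> (\<forall>y \<in> closed_nbhd G x - {xs ! h}. closed_nbhd G y = closed_nbhd G x)"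
  proof cases
    case 1
    define K where "K = set (take (Suc h) xs)"
    have "card K = Suc h" "K \<subseteq> set xs"
      using d xs(2) by (auto simp: K_def distinct_card dest: in_set_takeD)
    moreover have "closed_nbhd G u = K" if "u \<in> K - {xs ! h}" for u
      using closed_nbhd_left[OF xs, of u] that take by (auto simp: K_def)
    moreover have "xs ! h \<in> K" "x \<in> K" using take 1 by (auto simp: K_def)
    ultimately show ?thesis using x(2) by auto
  next
    case 2
    define K where "K = set (drop h xs)"
    have "card K = Suc h" "K \<subseteq> set xs"
      using d xs(2) by (auto simp: K_def distinct_card dest: in_set_dropD)
    moreover have "closed_nbhd G u = K" if "u \<in> K - {xs ! h}" for u
      using closed_nbhd_right[OF xs, of u] that drop by (auto simp: K_def)
    moreover have "xs ! h \<in> K" "x \<in> K" using drop 2 by (auto simp: K_def)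
    ultimately show ?thesis using x(2) by auto
  qed
  then show "closed_nbhd G x \<subseteq> set xs" "xs ! h \<in> closed_nbhd G x" "card (closed_nbhd G x) = Suc h"
    "y \<in> closed_nbhd G x \<Longrightarrow> y \<noteq> xs ! h \<Longrightarrow> closed_nbhd G y = closed_nbhd G x" by blast+
qed

text \<open>
  Walk from the middle vertex to \<open>w\<close> and onwards as far as possible, after the first half of the
  given path.  The final vertex has all its neighbours among the middle vertex and the new ones,
  since the closed neighbourhoods of the vertices before the middle stay inside the first half.
  Its degree makes the new part at least \<open>h\<close> long, so the path is again a longest one.
\<close>

lemma neighbour_of_middle_on_path:
  assumes xs: "simple_path G xs" "length xs = 2 * h + 1"
    and w: "(xs ! h, w) \<in> parcs G" "w \<notin> set (take (Suc h) xs)"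
  obtains zs where "simple_path G zs" "length zs = 2 * h + 1" "zs ! h = xs ! h" "w \<in> set zs"
proof -
  define as where "as = take (Suc h) xs"
  have as_snoc: "as = take h xs @ [xs ! h]" using xs(2) by (simp add: as_def take_Suc_conv_app_nth)
  have as: "simple_path G as" "last as = xs ! h" "length as = Suc h" "as \<noteq> []"
    using simple_path_take[OF xs(1), of "Suc h"] xs(2) as_snoc by (simp_all add: as_def)
  have "simple_path G (as @ [w])"
    using as(1,2,4) w in_arcsD2[OF w(1)]
    by (simp add: simple_path_append_iff simple_path_singleton as_def)
  moreover have "\<forall>ds. simple_path G (as @ w # ds) \<longrightarrow> length ds < 2 * h + 1"
    using no_long_path as(3) by fastforce
  ultimately have "\<exists>ds. simple_path G (as @ w # ds) \<and>
      (\<forall>ds'. simple_path G (as @ w # ds') \<longrightarrow> length ds' \<le> length ds)"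
    by (rule ex_has_greatest_nat)
  then obtain ds where ds: "simple_path G (as @ w # ds)"
    "\<And>ds'. simple_path G (as @ w # ds') \<Longrightarrow> length ds' \<le> length ds" by blast
  define z where "z = last (w # ds)"
  have z: "z \<in> set (w # ds)" "z \<in> pverts G"
    using ds(1) last_in_set[of "w # ds"] by (auto simp: z_def simple_path_def)
  have disj: "distinct (as @ w # ds)" using ds(1) by (simp add: simple_path_def)
  have "neighbours G z \<subseteq> insert (xs ! h) (set (w # ds) - {z})"
  proof
    fix y assume y: "y \<in> neighbours G z"
    then have yE: "(z, y) \<in> parcs G" by (simp add: neighbours_def)
    have "y \<in> set (as @ w # ds)"
    proof (rule ccontr)
      assume "y \<notin> set (as @ w # ds)"
      then have "simple_path G ((as @ w # ds) @ [y])"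
        using ds(1) yE in_arcsD2[OF yE] unfolding simple_path_append_iff[of G "as @ w # ds"]
        by (simp add: z_def simple_path_singleton)
      then show False using ds(2)[of "ds @ [y]"] by simp
    qed
    moreover have "y \<noteq> z" using no_loops'[OF yE] by simp
    moreover have False if "y \<in> set (take h xs)"
    proof -
      have "z \<in> closed_nbhd G y"
        using arcs_symmetric[OF yE] by (simp add: closed_nbhd_def neighbours_def)
      then have "z \<in> set as" using closed_nbhd_left[OF xs that] by (simp add: as_def)
      then show False using disj z(1) by auto
    qed
    moreover have "set as = insert (xs ! h) (set (take h xs))"
      using xs(2) by (simp add: as_def take_Suc_conv_app_nth)
    ultimately show "y \<in> insert (xs ! h) (set (w # ds) - {z})" by auto
  qed
  then have "card (neighbours G z) \<le> card (insert (xs ! h) (set (w # ds) - {z}))"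
    by (rule card_mono[rotated]) simp
  also have "\<dots> \<le> Suc (card (set (w # ds) - {z}))" by (rule card_insert_le_m1) auto
  also have "\<dots> = Suc (length ds)"
    using disj z(1) distinct_card[of "w # ds"] by (subst card_Diff_singleton) auto
  finally have "h \<le> Suc (length ds)" using degree[OF z(2)] by simp
  then have "length (as @ w # ds) = 2 * h + 1" using no_long_path[OF ds(1)] as(3) by simp
  moreover have "(as @ w # ds) ! h = xs ! h"
    using as xs(2) by (simp add: nth_append as_def)
  ultimately show ?thesis using that[of "as @ w # ds"] ds(1) by simp
qed

text \<open>
  Being in a blade propagates along edges: inside a blade because the closed neighbourhoods
  agree, and from the centre because each of its neighbours lies on some longest path with the same
  middle vertex.
\<close>

lemma windmill_centre_middle:
  assumes xs: "simple_path G xs" "length xs = 2 * h + 1"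
  shows "windmill_centre G h (xs ! h)"
proof -
  define c where "c = xs ! h"
  define good where "good x \<longleftrightarrow> c \<in> closed_nbhd G x \<and> card (closed_nbhd G x) = Suc h \<and>
     (\<forall>y \<in> closed_nbhd G x - {c}. closed_nbhd G y = closed_nbhd G x)" for x
  have good_path: "good x"
    if "simple_path G zs" "length zs = 2 * h + 1" "zs ! h = c" "x \<in> set zs" "x \<noteq> c" for zs x
    using path_vertex_blade[OF that(1,2,4)] that(3,5) unfolding good_def by blast
  define T where "T = insert c {x \<in> pverts G. good x}"
  have c: "c \<in> pverts G" using xs nth_mem[of h xs] by (auto simp: c_def simple_path_def)
  have "T = pverts G"
  proof (rule ccontr)
    assume "T \<noteq> pverts G"
    then obtain u w where uw: "(u, w) \<in> parcs G" "u \<in> T" "w \<notin> T"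
      using edge_leaving[of T] c by (auto simp: T_def)
    have w: "w \<noteq> c" "\<not> good w" using uw(3) in_arcsD2[OF uw(1)] by (auto simp: T_def)
    show False
    proof (cases "u = c")
      case True
      have "w \<notin> set xs" using good_path[OF xs] w by (auto simp: c_def)
      then have "w \<notin> set (take (Suc h) xs)" by (auto dest: in_set_takeD)
      then obtain zs where "simple_path G zs" "length zs = 2 * h + 1" "zs ! h = c" "w \<in> set zs"
        using neighbour_of_middle_on_path[OF xs] uw(1) True unfolding c_def by blast
      then show False using good_path w by blast
    next
      case False
      then have u: "good u" using uw(2) by (auto simp: T_def)
      have "w \<in> closed_nbhd G u" using uw(1) by (simp add: closed_nbhd_def neighbours_def)
      then have "closed_nbhd G w = closed_nbhd G u" using u w(1) unfolding good_def by blast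
      then have "good w" using u unfolding good_def by metis
      then show False using w(2) by blast
    qed
  qed
  then show ?thesis
    using c unfolding windmill_centre_def good_def T_def c_def by blast
qed

text \<open>
  A longest path uses the centre and exactly two blades.  The order is greater than \<open>2 * h + 1\<close>,
  so there is a third blade.
\<close>

lemma path_in_third_blade:
  assumes xs: "simple_path G xs" "length xs = 2 * h + 1"
  obtains zs where "simple_path G zs" "length zs = h" "set zs \<inter> set xs = {}"
proof -
  define c where "c = xs ! h"
  have wc: "windmill_centre G h c" using windmill_centre_middle[OF xs] by (simp add: c_def)
  have "distinct xs" "set xs \<subseteq> pverts G" using xs(1) by (auto simp: simple_path_def)
  then have "\<not> pverts G \<subseteq> set xs"
    using xs(2) order distinct_card[of xs] by auto
  then obtain z where z: "z \<in> pverts G" "z \<notin> set xs" by blast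
  have cxs: "c \<in> set xs" using xs(2) by (simp add: c_def)
  define K where "K = closed_nbhd G z - {c}"
  have cl: "c \<in> closed_nbhd G z" "card (closed_nbhd G z) = Suc h"
    "\<And>y. y \<in> K \<Longrightarrow> closed_nbhd G y = closed_nbhd G z"
    using wc z cxs unfolding windmill_centre_def K_def by blast+
  have fin: "finite K" by (simp add: K_def closed_nbhd_def)
  obtain zs where zs: "set zs = K" "distinct zs" using finite_distinct_list[OF fin] by blast
  have "card K = h" using cl(1,2) by (simp add: K_def)
  then have len: "length zs = h" using zs distinct_card by metis
  have edge: "(u, v) \<in> parcs G" if "u \<in> K" "v \<in> K" "u \<noteq> v" for u v
  proof -
    have "v \<in> closed_nbhd G u" using cl(3)[OF that(1)] that(2) by (simp add: K_def)
    then show ?thesis using that(3) by (simp add: closed_nbhd_def neighbours_def)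
  qed
  have "K \<subseteq> pverts G" using z in_arcsD2 by (auto simp: K_def closed_nbhd_def neighbours_def)
  then have "simple_path G zs"
    using zs len h_pos edge unfolding simple_path_def successively_conv_nth
    by (metis One_nat_def Suc_lessD list.size(3) n_not_Suc_n not_one_le_zero nth_eq_iff_index_eq nth_mem)
  moreover have "set zs \<inter> set xs = {}"
  proof (rule ccontr)
    assume "set zs \<inter> set xs \<noteq> {}"
    then obtain u where u: "u \<in> K" "u \<in> set xs" using zs by auto
    then have "closed_nbhd G u \<subseteq> set xs"
      using path_vertex_blade(1)[OF xs u(2)] by (simp add: K_def c_def)
    moreover have "z \<in> closed_nbhd G u" unfolding cl(3)[OF u(1)] by (simp add: closed_nbhd_def)
    ultimately show False using z by blast
  qed
  ultimately show ?thesis using that len by blast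
qed

end

section \<open>Embeddings and isomorphisms\<close>

text \<open>
  Isomorphisms of the library carry separate maps for vertices and arcs; for graphs whose arcs
  are pairs of vertices, the vertex map determines everything.
\<close>

lemma graph_isoI:
  assumes "pair_wf_digraph G" "inj_on f (pverts G)"
    and "pverts H = f ` pverts G" "parcs H = map_prod f f ` parcs G"
  shows "graph_iso G H"
proof -
  interpret pair_wf_digraph G by fact
  let ?hom = "\<lparr>iso_verts = f, iso_arcs = map_prod f f, iso_head = snd, iso_tail = fst\<rparr>"
  have "inj_on (map_prod f f) (parcs G)"
    by (rule inj_on_subset[OF map_prod_inj_on[OF assms(2) assms(2)]])
      (auto dest: in_arcsD1 in_arcsD2)
  then have "digraph_isomorphism ?hom"
    using assms(2) wf_digraph_axioms by (auto simp: digraph_isomorphism_def)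
  moreover have "with_proj H = app_iso ?hom (with_proj G)"
    using assms(3,4) by (simp add: app_iso_def with_proj_def)
  ultimately show ?thesis unfolding graph_iso_def digraph_iso_def by blast
qed

lemma contained_inI:
  assumes "pair_wf_digraph H" "pair_wf_digraph G" "inj_on f (pverts H)"
    and "\<And>u. u \<in> pverts H \<Longrightarrow> f u \<in> pverts G"
    and "\<And>u v. (u, v) \<in> parcs H \<Longrightarrow> (f u, f v) \<in> parcs G"
  shows "contained_in H G"
proof -
  let ?H = "\<lparr>pverts = f ` pverts H, parcs = map_prod f f ` parcs H\<rparr>"
  have "pair_wf_digraph ?H"
    using assms(1) by unfold_locales (auto simp: pair_wf_digraph_def)
  then have "subgraph (with_proj ?H) (with_proj G)"
    using assms by (auto simp: subgraph_def wf_digraph_wp_iff compatible_def)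
  moreover have "graph_iso H ?H"
    using assms(1,3) by (intro graph_isoI[of H f]) auto
  ultimately show ?thesis unfolding contained_in_def by blast
qed

lemma disjoint_UNION_cong:
  assumes "\<And>i. i \<in> I \<Longrightarrow> G i = H i"
  shows "disjoint_UNION I G = disjoint_UNION I H"
  using assms by (auto simp: disjoint_UNION_def)

lemma pair_wf_disjoint_UNION_path_graph:
  "pair_wf_digraph (disjoint_UNION I (\<lambda>i. path_graph (b i)))"
  by unfold_locales (auto simp: disjoint_UNION_def path_graph_def)

lemma pair_wf_S_graph: "pair_wf_digraph (S_graph n h)"
  by unfold_locales (auto simp: S_graph_def graph_join_def disjoint_union_def complement_graph_def
      complete_graph_def)

lemma pverts_L_graph: "pverts (L_graph t h) = insert (Inl 0) (Inr ` ({1..t} \<times> {..<h}))"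
  by (auto simp: L_graph_def graph_join_def disjoint_union_def complete_graph_def copies_def
      disjoint_UNION_def)

lemma parcs_L_graph_iff:
  "(Inl a, Inl b) \<in> parcs (L_graph t h) \<longleftrightarrow> False"
  "(Inl a, Inr (i, u)) \<in> parcs (L_graph t h) \<longleftrightarrow> a = 0 \<and> 1 \<le> i \<and> i \<le> t \<and> u < h"
  "(Inr (i, u), Inl a) \<in> parcs (L_graph t h) \<longleftrightarrow> a = 0 \<and> 1 \<le> i \<and> i \<le> t \<and> u < h"
  "(Inr (i, u), Inr (j, v)) \<in> parcs (L_graph t h) \<longleftrightarrow>
     i = j \<and> 1 \<le> i \<and> i \<le> t \<and> u < h \<and> v < h \<and> u \<noteq> v"
  by (auto simp: L_graph_def graph_join_def disjoint_union_def complete_graph_def copies_def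
      disjoint_UNION_def)

context pair_graph
begin

lemma contained_in_S_graph:
  assumes S: "S \<subseteq> pverts G" "card S = h" "\<And>x. x \<in> pverts G - S \<Longrightarrow> neighbours G x \<subseteq> S"
  shows "contained_in G (S_graph (card (pverts G)) h)"
proof -
  have fin: "finite S" using S(1) pair_finite_verts by (rule finite_subset)
  obtain f where f: "bij_betw f S {0..<card S}" using ex_bij_betw_finite_nat[OF fin] by blast
  obtain g where g: "bij_betw g (pverts G - S) {0..<card (pverts G - S)}"
    using ex_bij_betw_finite_nat[of "pverts G - S"] pair_finite_verts by auto
  have card: "card (pverts G - S) = card (pverts G) - h" using S fin by (simp add: card_Diff_subset)
  have fl: "f x < h" if "x \<in> S" for x using f that S(2) by (auto simp: bij_betw_def)
  have gl: "g x < card (pverts G) - h" if "x \<in> pverts G" "x \<notin> S" for x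
    using g that card by (auto simp: bij_betw_def)
  define F where "F x = (if x \<in> S then Inl (f x) else Inr (g x))" for x
  show ?thesis
  proof (rule contained_inI[of _ _ F])
    show "pair_wf_digraph G" by unfold_locales
    show "pair_wf_digraph (S_graph (card (pverts G)) h)" by (rule pair_wf_S_graph)
    show "inj_on F (pverts G)"
    proof (rule inj_onI)
      fix x y assume xy: "x \<in> pverts G" "y \<in> pverts G" "F x = F y"
      then show "x = y"
        using bij_betw_imp_inj_on[OF f] bij_betw_imp_inj_on[OF g]
        by (auto simp: F_def split: if_splits dest: inj_onD)
    qed
    show "F x \<in> pverts (S_graph (card (pverts G)) h)" if "x \<in> pverts G" for x
      using that fl gl by (auto simp: F_def S_graph_def graph_join_def disjoint_union_def
          complement_graph_def complete_graph_def)
    fix x y assume e: "(x, y) \<in> parcs G"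
    then have v: "x \<in> pverts G" "y \<in> pverts G" "x \<noteq> y"
      using in_arcsD1 in_arcsD2 no_loops' by auto
    have "x \<in> S \<or> y \<in> S" using S(3)[of x] e v by (auto simp: neighbours_def)
    moreover have "f x \<noteq> f y" if "x \<in> S" "y \<in> S"
      using that v(3) bij_betw_imp_inj_on[OF f] by (auto dest: inj_onD)
    ultimately show "(F x, F y) \<in> parcs (S_graph (card (pverts G)) h)"
      using v fl gl by (auto simp: F_def S_graph_def graph_join_def disjoint_union_def
          complement_graph_def complete_graph_def image_iff)
  qed
qed

text \<open>
  Sending a vertex other than the centre to the number of its blade and its number within the
  blade is an isomorphism, because two such vertices are adjacent iff they are distinct and have the
  same blade.
\<close>

lemma windmill_graph_iso:
  assumes c: "windmill_centre G h c"
  obtains t where "card (pverts G) = t * h + 1" "graph_iso G (L_graph t h)"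
proof -
  define blk where "blk x = closed_nbhd G x - {c}" for x
  define Bs where "Bs = blk ` (pverts G - {c})"
  have cG: "c \<in> pverts G" using c by (simp add: windmill_centre_def)
  have blk_card: "card B = h" "finite B" if B: "B \<in> Bs" for B
  proof -
    obtain x where x: "x \<in> pverts G - {c}" "B = closed_nbhd G x - {c}"
      using B unfolding Bs_def blk_def by blast
    then have "c \<in> closed_nbhd G x" "card (closed_nbhd G x) = Suc h"
      using c unfolding windmill_centre_def by blast+
    then show "card B = h" "finite B" using x(2) by (simp_all add: closed_nbhd_def)
  qed
  have blk_self: "x \<in> blk x" if "x \<in> pverts G - {c}" for x
    using that by (simp add: blk_def closed_nbhd_def)
  have blk_eq: "blk y = blk x" if "x \<in> pverts G - {c}" "y \<in> blk x" for x y
  proof -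
    have "closed_nbhd G y = closed_nbhd G x"
      using c that unfolding windmill_centre_def blk_def by blast
    then show ?thesis unfolding blk_def by simp
  qed
  have blk_sub: "blk x \<subseteq> pverts G - {c}" if "x \<in> pverts G - {c}" for x
    using that in_arcsD2 unfolding blk_def closed_nbhd_def neighbours_def by blast
  have adj: "(x, y) \<in> parcs G \<longleftrightarrow> x \<noteq> y \<and> blk x = blk y"
    if "x \<in> pverts G - {c}" "y \<in> pverts G - {c}" for x y
  proof
    assume e: "(x, y) \<in> parcs G"
    then have "y \<in> blk x" using that by (simp add: blk_def closed_nbhd_def neighbours_def)
    then show "x \<noteq> y \<and> blk x = blk y" using blk_eq[OF that(1)] no_loops'[OF e] by metis
  next
    assume "x \<noteq> y \<and> blk x = blk y"
    then have "y \<in> blk x" "x \<noteq> y" using blk_self[OF that(2)] by auto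
    then show "(x, y) \<in> parcs G" by (simp add: blk_def closed_nbhd_def neighbours_def)
  qed
  have adjc: "(c, x) \<in> parcs G" "(x, c) \<in> parcs G" if "x \<in> pverts G - {c}" for x
  proof -
    have "c \<in> closed_nbhd G x" using c that unfolding windmill_centre_def by blast
    then show "(x, c) \<in> parcs G" using that by (auto simp: closed_nbhd_def neighbours_def)
    then show "(c, x) \<in> parcs G" by (rule arcs_symmetric)
  qed
  have finB: "finite Bs" using pair_finite_verts by (simp add: Bs_def)
  define t where "t = card Bs"
  obtain idx where idx: "bij_betw idx Bs {1..t}"
    using ex_bij_betw_nat_finite_1[OF finB] bij_betw_inv unfolding t_def by blast
  have "\<exists>l. bij_betw l B {0..<h}" if "B \<in> Bs" for B
    using ex_bij_betw_finite_nat[OF blk_card(2)[OF that]] blk_card(1)[OF that] by simp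
  then obtain loc where loc: "\<And>B. B \<in> Bs \<Longrightarrow> bij_betw (loc B) B {0..<h}" by metis
  define F where "F x = (if x = c then Inl (0::nat) else Inr (idx (blk x), loc (blk x) x))" for x
  have inBs: "blk x \<in> Bs" if "x \<in> pverts G - {c}" for x using that by (simp add: Bs_def)
  have idx_eq: "idx (blk x) = idx (blk y) \<longleftrightarrow> blk x = blk y"
    if "x \<in> pverts G - {c}" "y \<in> pverts G - {c}" for x y
    using inj_on_eq_iff[OF bij_betw_imp_inj_on[OF idx]] inBs that by simp
  have F_eq: "idx (blk x) = idx (blk y) \<and> loc (blk x) x = loc (blk y) y \<longleftrightarrow> x = y"
    if "x \<in> pverts G - {c}" "y \<in> pverts G - {c}" for x y
    using idx_eq[OF that] inj_onD[OF bij_betw_imp_inj_on[OF loc[OF inBs[OF that(1)]]], of x y]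
      blk_self that by metis
  have inj: "inj_on F (pverts G)"
  proof (rule inj_onI)
    fix x y assume "x \<in> pverts G" "y \<in> pverts G" "F x = F y"
    then show "x = y" using F_eq[of x y] by (auto simp: F_def split: if_splits)
  qed
  have bounds: "1 \<le> idx (blk x)" "idx (blk x) \<le> t" "loc (blk x) x < h" if "x \<in> pverts G - {c}" for x
    using bij_betw_apply[OF idx inBs[OF that]] bij_betw_apply[OF loc[OF inBs[OF that]] blk_self[OF that]]
    by auto
  have img: "F ` pverts G = pverts (L_graph t h)"
  proof (intro equalityI subsetI)
    fix p assume "p \<in> F ` pverts G"
    then obtain x where x: "x \<in> pverts G" "p = F x" by blast
    then show "p \<in> pverts (L_graph t h)"
      using bounds[of x] unfolding pverts_L_graph by (auto simp: F_def)
  next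
    fix p assume p: "p \<in> pverts (L_graph t h)"
    show "p \<in> F ` pverts G"
    proof (cases "p = Inl 0")
      case True
      then show ?thesis using cG by (intro image_eqI[of _ _ c]) (auto simp: F_def)
    next
      case False
      then obtain i u where iu: "p = Inr (i, u)" "i \<in> {1..t}" "u < h"
        using p unfolding pverts_L_graph by auto
      obtain B where B: "B \<in> Bs" "idx B = i"
        using bij_betw_imp_surj_on[OF idx] iu(2) by (metis imageE)
      have "u \<in> loc B ` B" using bij_betw_imp_surj_on[OF loc[OF B(1)]] iu(3) by simp
      then obtain y where y: "y \<in> B" "loc B y = u" by (metis imageE)
      obtain x where x: "x \<in> pverts G - {c}" "B = blk x" using B(1) unfolding Bs_def by blast
      have "blk y = B" "y \<in> pverts G - {c}" using blk_eq[OF x(1)] blk_sub[OF x(1)] x y by auto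
      then show ?thesis using B y iu by (intro image_eqI[of _ _ y]) (auto simp: F_def)
    qed
  qed
  have arcs: "(F x, F y) \<in> parcs (L_graph t h) \<longleftrightarrow> (x, y) \<in> parcs G"
    if xy: "x \<in> pverts G" "y \<in> pverts G" for x y
  proof (cases "x = c \<or> y = c")
    case True
    then show ?thesis
      using xy adjc[of x] adjc[of y] bounds[of x] bounds[of y] no_loops'[of c c]
      by (auto simp: F_def parcs_L_graph_iff)
  next
    case False
    then have xy': "x \<in> pverts G - {c}" "y \<in> pverts G - {c}" using xy by auto
    have "(F x, F y) \<in> parcs (L_graph t h) \<longleftrightarrow>
        idx (blk x) = idx (blk y) \<and> loc (blk x) x \<noteq> loc (blk y) y"
      using False bounds[OF xy'(1)] bounds[OF xy'(2)] by (auto simp: F_def parcs_L_graph_iff)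
    then show ?thesis using adj[OF xy'] idx_eq[OF xy'] F_eq[OF xy'] by metis
  qed
  have arcs_verts: "p \<in> pverts (L_graph t h) \<and> q \<in> pverts (L_graph t h)"
    if "(p, q) \<in> parcs (L_graph t h)" for p q
    using that unfolding pverts_L_graph
    by (cases p; cases q) (auto simp: parcs_L_graph_iff image_iff)
  have "parcs (L_graph t h) = map_prod F F ` parcs G"
  proof (intro equalityI subrelI)
    fix p q assume pq: "(p, q) \<in> parcs (L_graph t h)"
    then have "p \<in> F ` pverts G" "q \<in> F ` pverts G" using arcs_verts unfolding img by simp_all
    then obtain x y where "x \<in> pverts G" "y \<in> pverts G" "p = F x" "q = F y" by blast
    then show "(p, q) \<in> map_prod F F ` parcs G" using arcs pq by (auto intro!: image_eqI)
  next
    fix p q assume "(p, q) \<in> map_prod F F ` parcs G"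
    then obtain x y where "(x, y) \<in> parcs G" "p = F x" "q = F y" by auto
    then show "(p, q) \<in> parcs (L_graph t h)" using arcs[OF in_arcsD1 in_arcsD2] by blast
  qed
  then have "graph_iso G (L_graph t h)"
    using img inj by (intro graph_isoI[of G F]) (auto intro: pair_wf_digraph_axioms)
  moreover have "card (pverts G) = t * h + 1"
  proof -
    have "card (pverts G) = card (pverts (L_graph t h))" using card_image[OF inj] img by simp
    also have "\<dots> = Suc (card (Inr ` ({1..t} \<times> {..<h}) :: (nat + nat \<times> nat) set))"
      unfolding pverts_L_graph by (subst card_insert_disjoint) auto
    also have "\<dots> = t * h + 1" by (simp add: card_image card_cartesian_product)
    finally show ?thesis .
  qed
  ultimately show ?thesis using that by blast
qed

text \<open>
  All components but the last are cut consecutively out of one path, and the last one out of a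
  second path disjoint from the first.  The two paths may be the parts of a single long path.
\<close>

lemma linear_forest_contained_in:
  fixes b :: "nat \<Rightarrow> nat"
  assumes ps: "simple_path G ps" "(\<Sum>i=1..<k. b i) \<le> length ps"
    and qs: "simple_path G qs" "b k \<le> length qs"
    and disj: "set ps \<inter> set qs = {}"
  shows "contained_in (disjoint_UNION {1..k} (\<lambda>i. path_graph (b i))) G"
proof -
  let ?F = "disjoint_UNION {1..k} (\<lambda>i. path_graph (b i))"
  define s where "s i = (\<Sum>j=1..<i. b j)" for i
  define f where "f = (\<lambda>(i, u). if i < k then ps ! (s i + u) else qs ! u)"
  have mono: "s i + b i \<le> s j" if "1 \<le> i" "i < j" for i j
  proof -
    have "s i + b i = (\<Sum>j=1..<Suc i. b j)" using that(1) by (simp add: s_def)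
    also have "\<dots> \<le> s j" unfolding s_def using that by (intro sum_mono2) auto
    finally show ?thesis .
  qed
  have vF: "pverts ?F = {(i, u). 1 \<le> i \<and> i \<le> k \<and> u < b i}"
    by (auto simp: disjoint_UNION_def path_graph_def)
  have lt: "s i + u < length ps" if "1 \<le> i" "i < k" "u < b i" for i u
    using mono[OF that(1,2)] that(3) ps(2) by (simp add: s_def)
  have dist: "distinct ps" "distinct qs" using ps(1) qs(1) by (auto simp: simple_path_def)
  have sub: "set ps \<subseteq> pverts G" "set qs \<subseteq> pverts G" using ps(1) qs(1) by (auto simp: simple_path_def)
  have fv: "f (i, u) \<in> (if i < k then set ps else set qs)" if "(i, u) \<in> pverts ?F" for i u
    using that lt qs(2) unfolding vF by (auto simp: f_def)
  show ?thesis
  proof (rule contained_inI[of _ _ f])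
    show "pair_wf_digraph ?F" by (rule pair_wf_disjoint_UNION_path_graph)
    show "pair_wf_digraph G" by unfold_locales
    show "f p \<in> pverts G" if "p \<in> pverts ?F" for p
      using fv[of "fst p" "snd p"] that sub by (auto split: if_splits)
    show "inj_on f (pverts ?F)"
    proof (rule inj_onI, clarify)
      fix i u j v assume iu: "(i, u) \<in> pverts ?F" and jv: "(j, v) \<in> pverts ?F"
        and eq: "f (i, u) = f (j, v)"
      have b: "1 \<le> i" "i \<le> k" "u < b i" "1 \<le> j" "j \<le> k" "v < b j"
        using iu jv unfolding vF by auto
      have side: "i < k \<longleftrightarrow> j < k" using fv[OF iu] fv[OF jv] eq disj by (auto split: if_splits)
      show "i = j \<and> u = v"
      proof (cases "i < k")
        case True
        then have "s i + u = s j + v"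
          using eq lt b side dist by (simp add: f_def nth_eq_iff_index_eq)
        then show ?thesis using mono[of i j] mono[of j i] b by (cases i j rule: linorder_cases) auto
      next
        case False
        then show ?thesis using eq b side qs(2) dist by (auto simp: f_def nth_eq_iff_index_eq)
      qed
    qed
    have step: "(f (i, u), f (i, Suc u)) \<in> parcs G" if "1 \<le> i" "i \<le> k" "Suc u < b i" for i u
      using that lt[of i "Suc u"] simple_path_nth[OF ps(1), of "s i + u"]
        simple_path_nth[OF qs(1), of u] qs(2) by (auto simp: f_def)
    fix p q assume "(p, q) \<in> parcs ?F"
    then obtain i u v where "p = (i, u)" "q = (i, v)" "1 \<le> i" "i \<le> k" "u < b i" "v < b i"
      "v = Suc u \<or> u = Suc v"
      by (auto simp: disjoint_UNION_def path_graph_def)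
    then show "(f p, f q) \<in> parcs G" using step arcs_symmetric by auto
  qed
qed

end

section \<open>Linear forests in connected graphs of given minimum degree\<close>

theorem theorem1p8:
  fixes G :: "'a pair_pre_digraph"
    and F :: "(nat \<times> nat) pair_pre_digraph"
    and a :: "nat \<Rightarrow> nat"
    and k h n :: nat
  assumes "k \<ge> 2"
    and "\<forall>i j. 1 \<le> i \<and> i \<le> j \<and> j \<le> k \<longrightarrow> a j \<le> a i"
    and "a k \<ge> 1"
    and "F = disjoint_UNION {1..k} (\<lambda>i. path_graph (2 * a i))"
    and "h = (\<Sum>i=1..k. a i) - 1"
    and "h \<ge> 1"
    and "pair_graph G"
    and "Digraph_Component.connected (with_proj G)"
    and "card (pverts G) = n"
    and "n \<ge> 2 * h + 2"
    and "min_degree G \<ge> h"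
  shows "contained_in F G
    \<or> contained_in G (S_graph n h)
    \<or> (graph_iso F (copies 2 (path_graph (2 * a 1)))
        \<and> (\<exists>t. n = t * h + 1 \<and> graph_iso G (L_graph t h)))"
proof -
  interpret pair_graph G by fact
  have deg: "h \<le> card (neighbours G x)" if "x \<in> pverts G" for x
  proof -
    have "min_degree G \<le> out_degree (with_proj G) x"
      unfolding min_degree_def using that pair_finite_verts by (intro Min_le) auto
    then show ?thesis using assms(11) by (simp add: card_neighbours)
  qed
  interpret connected_min_degree_graph G h
    using assms(6,8,9,10) deg by unfold_locales auto
  have total: "(\<Sum>i=1..<k. a i) + a k = h + 1"
  proof -
    have "{1..k} = insert k {1..<k}" using assms(1) by auto
    then have "(\<Sum>i=1..k. a i) = (\<Sum>i=1..<k. a i) + a k" by simp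
    then show ?thesis using assms(5,6) by simp
  qed
  have double: "(\<Sum>i=1..<k. 2 * a i) = 2 * (\<Sum>i=1..<k. a i)" by (simp add: sum_distrib_left)
  show ?thesis
  proof (cases "\<exists>xs. simple_path G xs \<and> 2 * h + 2 \<le> length xs")
    case True
    then obtain xs where xs: "simple_path G xs" "2 * h + 2 \<le> length xs" by blast
    \<comment> \<open>the first \<open>k - 1\<close> components go before position \<open>m\<close> of a long path, the last one after it\<close>
    define m where "m = (\<Sum>i=1..<k. 2 * a i)"
    have "a 1 \<le> (\<Sum>i=1..<k. a i)" using assms(1) by (intro member_le_sum) auto
    moreover have "1 \<le> a 1" using assms(2)[rule_format, of 1 k] assms(1,3) by simp
    ultimately have m: "0 < m" "m + 2 * a k \<le> length xs" "m < length xs"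
      using total double xs(2) assms(3) by (auto simp: m_def)
    have "contained_in F G"
      unfolding assms(4)
    proof (rule linear_forest_contained_in)
      show "simple_path G (take m xs)" using xs(1) m by (intro simple_path_take)
      show "simple_path G (drop m xs)" using xs(1) m by (intro simple_path_drop)
      show "set (take m xs) \<inter> set (drop m xs) = {}"
        using xs(1) by (simp add: simple_path_def set_take_disj_set_drop_if_distinct)
    qed (use m in \<open>auto simp: m_def\<close>)
    then show ?thesis ..
  next
    case False
    interpret no_long_path_graph G h
      using False by unfold_locales force
    show ?thesis
    proof (cases "\<exists>cs. closed_path G cs \<and> length cs = 2 * h")
      case True
      then obtain cs where "closed_path G cs" "length cs = 2 * h" by blast
      then obtain S where "S \<subseteq> pverts G" "card S = h" "\<And>x. x \<in> pverts G - S \<Longrightarrow> neighbours G x \<subseteq> S"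
        using closed_path_independent_complement by metis
      then have "contained_in G (S_graph n h)"
        using contained_in_S_graph assms(9) by blast
      then show ?thesis by blast
    next
      case False
      interpret no_long_path_no_closed_path_graph G h
        using False by unfold_locales auto
      obtain xs where xs: "simple_path G xs" "length xs = 2 * h + 1" by (rule ex_path_length)
      show ?thesis
      proof (cases "2 * a k \<le> h")
        case True
        \<comment> \<open>the last component moves to the third blade, and the others then fit on the longest path\<close>
        obtain zs where zs: "simple_path G zs" "length zs = h" "set zs \<inter> set xs = {}"
          using path_in_third_blade[OF xs] .
        have "contained_in F G"
          unfolding assms(4)
        proof (rule linear_forest_contained_in[where ps = xs and qs = zs])
          show "(\<Sum>i=1..<k. 2 * a i) \<le> length xs"
            using total double xs(2) assms(3) by simp
        qed (use xs zs True in \<open>auto simp: Int_commute\<close>)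
        then show ?thesis ..
      next
        case False
        \<comment> \<open>the last component, a shortest one, has at least half of the \<open>2 * h + 2\<close> vertices of the forest\<close>
        have ge: "a k \<le> a i" if "1 \<le> i" "i < k" for i using assms(2)[rule_format, of i k] that by simp
        have "(k - 1) * a k \<le> (\<Sum>i=1..<k. a i)"
          using sum_bounded_below[of "{1..<k}" "a k" a] ge by auto
        moreover have "(\<Sum>i=1..<k. a i) \<le> a k" using False total by linarith
        ultimately have "(k - 1) * a k \<le> a k" by (rule order_trans)
        then have k: "k = 2"
          using mult_le_mono1[of 2 "k - 1" "a k"] assms(1,3) by (cases "2 \<le> k - 1") auto
        moreover have "{1..<2::nat} = {1}" by auto
        ultimately have "a 1 = a 2"
          using \<open>(\<Sum>i=1..<k. a i) \<le> a k\<close> ge[of 1] by simp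
        have "a i = a 1" if "i \<in> {1..2}" for i
        proof -
          have "i = 1 \<or> i = 2" using that by auto
          then show ?thesis using \<open>a 1 = a 2\<close> by metis
        qed
        then have "F = copies 2 (path_graph (2 * a 1))"
          unfolding assms(4) k copies_def by (intro disjoint_UNION_cong) metis
        moreover have "graph_iso F F"
          unfolding assms(4)
          by (rule graph_isoI[OF pair_wf_disjoint_UNION_path_graph, of id]) (simp_all add: map_prod.id)
        ultimately have "graph_iso F (copies 2 (path_graph (2 * a 1)))" by simp
        moreover obtain t where "card (pverts G) = t * h + 1" "graph_iso G (L_graph t h)"
          using windmill_graph_iso[OF windmill_centre_middle[OF xs]] .
        ultimately show ?thesis using assms(9) by blast
      qed
    qed
  qed
qed

end
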